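(* Let $\lambda$ be a nonzero real number. For every integer $n\ge 1$ and every real $x$ (equivalently, as an identity of polynomials in $x$ over $\mathbb{R}$), $$\beta_{n,\lambda}(x)=(x+1)_{n,\lambda}-\frac{M_{n+1,\lambda}}{n+1}+\sum_{k=2}^{n}(-1)^{k}k!\,B_{n,k}\big(\beta_{1,\lambda}(x),\beta_{2,\lambda}(x),\dots,\beta_{n-k+1,\lambda}(x)\big)$$ $$\qquad+\sum_{j=1}^{n-1}\sum_{k=1}^{j}\binom{n}{j}(x+1)_{n-j,\lambda}(-1)^{k}k!\,B_{j,k}\big(\beta_{1,\lambda}(x),\beta_{2,\lambda}(x),\dots,\beta_{j-k+1,\lambda}(x)\big),$$ where $\beta_{n,\lambda}(x)$ are the degenerate Bernoulli polynomials, $(x)_{n,\lambda}$ is the degenerate falling factorial, $M_{n,\lambda}$ are the dimorphic Mersenne numbers, and $B_{n,k}$ are the incomplete Bell polynomials; empty sums are $0$.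
   Context: Let $\lambda\in\mathbb{R}$ be nonzero. The degenerate falling factorial is $(x)_{0,\lambda}=1$ and $(x)_{n,\lambda}=x(x-\lambda)(x-2\lambda)\cdots(x-(n-1)\lambda)$ for $n\ge 1$. The degenerate exponentials are the formal power series in $t$ $$e_{\lambda}^{x}(t)=(1+\lambda t)^{x/\lambda}=\sum_{n=0}^{\infty}(x)_{n,\lambda}\frac{t^{n}}{n!},\qquad e_{\lambda}(t)=e_{\lambda}^{1}(t).$$ The degenerate Bernoulli polynomials $\beta_{n,\lambda}(x)$, $n\ge 0$, are defined by $$\frac{t}{e_{\lambda}(t)-1}e_{\lambda}^{x}(t)=\sum_{n=0}^{\infty}\beta_{n,\lambda}(x)\frac{t^{n}}{n!}.$$ The dimorphic Mersenne numbers are $M_{n,\lambda}=(2)_{n,\lambda}-(1)_{n,\lambda}$ for $n\ge 0$. The incomplete Bell polynomials $B_{n,k}(x_{1},\dots,x_{n-k+1})$ are defined, for $k\ge 0$, by $$\frac{1}{k!}\bigg(\sum_{i=1}^{\infty}x_{i}\frac{t^{i}}{i!}\bigg)^{k}=\sum_{n=k}^{\infty}B_{n,k}(x_{1},\dots,x_{n-k+1})\frac{t^{n}}{n!};$$ explicitly, $$B_{n,k}(x_{1},\dots,x_{n-k+1})=\sum\frac{n!}{l_{1}!l_{2}!\cdots l_{n-k+1}!}\Big(\frac{x_{1}}{1!}\Big)^{l_{1}}\Big(\frac{x_{2}}{2!}\Big)^{l_{2}}\cdots\Big(\frac{x_{n-k+1}}{(n-k+1)!}\Big)^{l_{n-k+1}},$$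 the sum being over all nonnegative integers $l_{1},\dots,l_{n-k+1}$ with $l_{1}+\cdots+l_{n-k+1}=k$ and $l_{1}+2l_{2}+\cdots+(n-k+1)l_{n-k+1}=n$. *)

theory Defs
  imports "HOL-Computational_Algebra.Formal_Power_Series"
begin

definition deg_ffact :: "real \<Rightarrow> nat \<Rightarrow> real \<Rightarrow> real" where
  "deg_ffact lam n x = (\<Prod>i<n. x - of_nat i * lam)"

definition deg_exp :: "real \<Rightarrow> real \<Rightarrow> real fps" where
  "deg_exp lam x = Abs_fps (\<lambda>n. deg_ffact lam n x / fact n)"

text \<open>The closed form \<open>(1 + lam t)\<close> to the power \<open>x / lam\<close>, with the library's binomial series.\<close>

lemma deg_exp_eq_binomial:
  assumes "lam \<noteq> 0"
  shows "deg_exp lam x = fps_binomial (x / lam) oo (fps_const lam * fps_X)"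
proof (rule fps_ext)
  fix n
  have "deg_ffact lam n x = lam ^ n * (\<Prod>i<n. x / lam - of_nat i)"
    using assms
    by (induction n) (auto simp: deg_ffact_def field_simps)
  then show "fps_nth (deg_exp lam x) n = fps_nth (fps_binomial (x / lam) oo (fps_const lam * fps_X)) n"
    by (simp add: deg_exp_def fps_compose_linear gbinomial_prod_rev atLeast0LessThan)
qed

text \<open>
  The division is that of formal power series: the divisor has zero constant term, but its
  linear coefficient is \<open>1\<close>, so the quotient is exact (see \<open>deg_Bernoulli_quotient\<close>).
\<close>

definition deg_Bernoulli :: "real \<Rightarrow> nat \<Rightarrow> real \<Rightarrow> real" where
  "deg_Bernoulli lam n x = fact n * fps_nth (fps_X / (deg_exp lam 1 - 1) * deg_exp lam x) n"

lemma deg_Bernoulli_quotient: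
  "fps_X / (deg_exp lam 1 - 1) * (deg_exp lam 1 - 1) = fps_X"
proof -
  have 0: "fps_nth (deg_exp lam 1 - 1) 0 = 0" and 1: "fps_nth (deg_exp lam 1 - 1) 1 = 1"
    by (simp_all add: deg_exp_def deg_ffact_def)
  have "subdegree (deg_exp lam 1 - 1) = 1"
    by (rule subdegreeI) (use 0 1 in auto)
  then have "deg_exp lam 1 - 1 dvd fps_X"
    using 1 by (subst fps_dvd_iff) auto
  then show ?thesis
    by simp
qed

lemma deg_Bernoulli_gf:
  "Abs_fps (\<lambda>n. deg_Bernoulli lam n x / fact n) = fps_X / (deg_exp lam 1 - 1) * deg_exp lam x"
  by (rule fps_ext) (simp add: deg_Bernoulli_def)

definition Mersenne :: "real \<Rightarrow> nat \<Rightarrow> real" where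
  "Mersenne lam n = deg_ffact lam n 2 - deg_ffact lam n 1"

text \<open>
  The arguments are given as an infinite sequence \<open>x 1, x 2, \<dots>\<close>; the value \<open>x 0\<close> is ignored, and
  only \<open>x 1, \<dots>, x (n - k + 1)\<close> matter (see \<open>Bell_incomplete_cong\<close>).
\<close>

definition Bell_incomplete :: "nat \<Rightarrow> nat \<Rightarrow> (nat \<Rightarrow> real) \<Rightarrow> real" where
  "Bell_incomplete n k x =
     fact n * fps_nth (fps_const (1 / fact k) * Abs_fps (\<lambda>i. if i = 0 then 0 else x i / fact i) ^ k) n"

lemma Bell_incomplete_eq_0:
  assumes "n < k"
  shows "Bell_incomplete n k x = 0"
  using assms by (simp add: Bell_incomplete_def startsby_zero_power_prefix)

lemma Bell_incomplete_cong:
  assumes "k \<le> n" and "\<And>i. 1 \<le> i \<Longrightarrow> i \<le> n - k + 1 \<Longrightarrow> x i = y i"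
  shows "Bell_incomplete n k x = Bell_incomplete n k y"
proof -
  define S :: "(nat \<Rightarrow> real) \<Rightarrow> real fps" where "S z = Abs_fps (\<lambda>i. z (Suc i) / fact (Suc i))" for z
  have shift: "Abs_fps (\<lambda>i. if i = 0 then 0 else z i / fact i) = fps_X * S z" for z
    by (rule fps_ext) (auto simp: S_def simp del: fact_Suc)
  have "fps_nth (S x ^ j) m = fps_nth (S y ^ j) m" if "m \<le> n - k" for j m
    using that
  proof (induction j arbitrary: m)
    case (Suc j)
    have "fps_nth (S x) i = fps_nth (S y) i" if "i \<le> m" for i
      using that Suc.prems assms(2)[of "Suc i"] by (simp add: S_def del: fact_Suc)
    with Suc show ?case
      by (auto simp: fps_mult_nth intro!: sum.cong)
  qed simp
  then have "fps_nth (S x ^ k) (n - k) = fps_nth (S y ^ k) (n - k)"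
    by simp
  then show ?thesis
    using assms(1)
    by (simp add: Bell_incomplete_def shift power_mult_distrib fps_X_power_mult_nth)
qed

end

(* With F the generating function of the degenerate Bernoulli polynomials at x, F(0) = 1 and
   e^(x+1) / F = e * (e - 1) / t = (e^2 - e) / t, whose coefficients are the M_(n+1) / (n+1)!.
   Expanding 1 / F = sum_k (-1)^k (F - 1)^k in incomplete Bell polynomials and comparing coefficients
   gives the recurrence; beta_n itself is the k = 1 term of the coefficient of 1 / F. *)

theory Submission
  imports Defs
begin

text \<open>The closed form as a binomial series reduces this to the exponent law for
  \<open>fps_binomial\<close>.\<close>

lemma deg_exp_add:
  assumes "lam \<noteq> 0"
  shows "deg_exp lam (x + y) = deg_exp lam x * deg_exp lam y"
  using assms
  by (simp add: deg_exp_eq_binomial add_divide_distrib fps_binomial_add_mult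
      fps_compose_mult_distrib)

lemma deg_exp_nth: "fps_nth (deg_exp lam x) n = deg_ffact lam n x / fact n"
  by (simp add: deg_exp_def)

text \<open>The alternating geometric series is inverse to \<open>1 + fps_X\<close>, and
  substituting a series without constant term respects products. The inverse of \<open>1 + G\<close>
  is thereby expanded in powers of \<open>G\<close>.\<close>

lemma fps_geometric_compose:
  fixes G :: "'a :: idom fps"
  assumes "fps_nth G 0 = 0"
  shows "(Abs_fps (\<lambda>k. (-1) ^ k) oo G) * (1 + G) = 1"
proof -
  have "Abs_fps (\<lambda>k. (-1) ^ k) * (1 + fps_X) = (1 :: 'a fps)"
  proof (rule fps_ext)
    fix n
    show "fps_nth (Abs_fps (\<lambda>k. (-1) ^ k) * (1 + fps_X)) n = fps_nth (1 :: 'a fps) n"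
      by (cases n) (simp_all add: distrib_left)
  qed
  then have "(Abs_fps (\<lambda>k. (-1) ^ k) * (1 + fps_X)) oo G = 1"
    by simp
  then show ?thesis
    using assms by (simp add: fps_compose_mult_distrib fps_compose_add_distrib)
qed

lemma Bell_incomplete_0: "Bell_incomplete n 0 f = (if n = 0 then 1 else 0)"
  by (simp add: Bell_incomplete_def)

lemma Bell_incomplete_1: "n \<ge> 1 \<Longrightarrow> Bell_incomplete n 1 f = f n"
  by (simp add: Bell_incomplete_def)

text \<open>The \<open>k\<close>-th power of the inner series is \<open>fact k\<close> times the
  exponential generating function of \<open>Bell_incomplete _ k f\<close>. Powers beyond
  \<open>j\<close> do not reach coefficient \<open>j\<close>.\<close>

lemma alternating_compose_nth_Bell:
  "fps_nth (Abs_fps (\<lambda>k. (-1) ^ k) oo Abs_fps (\<lambda>i. if i = 0 then 0 else f i / fact i)) j =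
    (\<Sum>k=0..j. (-1) ^ k * fact k * Bell_incomplete j k f) / fact j"
  by (simp add: fps_compose_nth Bell_incomplete_def sum_divide_distrib)

lemma deg_Bernoulli_0: "deg_Bernoulli lam 0 x = 1"
proof -
  have "subdegree (deg_exp lam 1 - 1) = 1"
    by (rule subdegreeI) (auto simp: deg_exp_nth deg_ffact_def)
  then have "fps_nth (fps_X / (deg_exp lam 1 - 1)) 0 = 1"
    \<comment> \<open>The divisor starts with \<open>fps_X\<close>, so the linear coefficient of the
      product is the constant term of the quotient.\<close>
    using arg_cong[OF deg_Bernoulli_quotient[of lam], of "\<lambda>f. fps_nth f 1"]
    by (simp add: fps_mult_nth deg_exp_nth deg_ffact_def)
  then show ?thesis
    by (simp add: deg_Bernoulli_def deg_exp_nth deg_ffact_def)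
qed

text \<open>Both sides are \<open>fact n\<close> times coefficient \<open>n\<close> of
  \<open>H * deg_exp lam (x + 1)\<close>, where \<open>H\<close> inverts the Bernoulli series: the
  left by the Cauchy product, the right from a closed form.\<close>

lemma deg_Bernoulli_Bell_convolution:
  assumes "lam \<noteq> 0"
  shows "(\<Sum>j=0..n. real (n choose j) * deg_ffact lam (n - j) (x + 1) *
      (\<Sum>k=0..j. (-1) ^ k * fact k * Bell_incomplete j k (\<lambda>i. deg_Bernoulli lam i x))) =
    Mersenne lam (n + 1) / real (n + 1)"
proof -
  define b where "b = (\<lambda>i. deg_Bernoulli lam i x)"
  define G where "G = Abs_fps (\<lambda>i. if i = 0 then 0 else b i / fact i)"
  define H where "H = (Abs_fps (\<lambda>k. (-1) ^ k) oo G)"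
  define F where "F = fps_X / (deg_exp lam 1 - 1) * deg_exp lam x"
  let ?e = "deg_exp lam 1"
  have "1 + G = F"
    unfolding F_def deg_Bernoulli_gf[symmetric]
    by (rule fps_ext) (simp add: G_def b_def deg_Bernoulli_0)
  then have HF: "H * F = 1"
    using fps_geometric_compose[of G] by (simp add: H_def G_def)
  have "fps_X * deg_exp lam x = F * (?e - 1)"
    by (metis F_def deg_Bernoulli_quotient mult.commute mult.left_commute)
  \<comment> \<open>Keeping the factor \<open>fps_X\<close> on the left avoids a division; it shifts
    the index, whence \<open>n + 1\<close> in the Mersenne number.\<close>
  then have "fps_X * (H * deg_exp lam (x + 1)) = (H * F) * ((?e - 1) * ?e)"
    using deg_exp_add[OF assms, of x 1] by (metis mult.assoc mult.left_commute)
  also have "\<dots> = deg_exp lam 2 - ?e"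
    using HF deg_exp_add[OF assms, of 1 1] by (simp add: algebra_simps)
  finally have "fps_nth (fps_X * (H * deg_exp lam (x + 1))) (Suc n) =
      fps_nth (deg_exp lam 2 - ?e) (Suc n)"
    by simp
  then have "fps_nth (H * deg_exp lam (x + 1)) n = Mersenne lam (n + 1) / fact (n + 1)"
    by (simp add: deg_exp_nth Mersenne_def diff_divide_distrib del: fact_Suc)
  then have "(\<Sum>j=0..n. fact n * (fps_nth H j * fps_nth (deg_exp lam (x + 1)) (n - j))) =
      Mersenne lam (n + 1) / real (n + 1)"
    by (simp add: fps_mult_nth flip: sum_distrib_left)
  moreover have "fact n * (fps_nth H j * fps_nth (deg_exp lam (x + 1)) (n - j)) =
      real (n choose j) * deg_ffact lam (n - j) (x + 1) *
      (\<Sum>k=0..j. (-1) ^ k * fact k * Bell_incomplete j k b)" if "j \<le> n" for j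
    using that
    by (simp add: H_def G_def alternating_compose_nth_Bell deg_exp_nth binomial_fact)
  ultimately show ?thesis
    by (simp add: b_def)
qed

theorem theorem3:
  fixes lam x :: real and n :: nat
  assumes "lam \<noteq> 0" and "n \<ge> 1"
  shows "deg_Bernoulli lam n x =
    deg_ffact lam n (x + 1) - Mersenne lam (n + 1) / real (n + 1)
    + (\<Sum>k=2..n. (-1) ^ k * fact k * Bell_incomplete n k (\<lambda>i. deg_Bernoulli lam i x))
    + (\<Sum>j=1..n-1. \<Sum>k=1..j. real (n choose j) * deg_ffact lam (n - j) (x + 1)
         * (-1) ^ k * fact k * Bell_incomplete j k (\<lambda>i. deg_Bernoulli lam i x))"
proof -
  define b where "b = (\<lambda>i. deg_Bernoulli lam i x)"
  define T where "T j k = (-1) ^ k * fact k * Bell_incomplete j k b" for j k :: nat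
  define w where "w j = real (n choose j) * deg_ffact lam (n - j) (x + 1)" for j
  have T_drop_0: "(\<Sum>k=0..j. T j k) = (\<Sum>k=1..j. T j k)" if "j \<ge> 1" for j
    using that by (simp add: sum.atLeast_Suc_atMost[of 0] T_def Bell_incomplete_0)
  obtain m where n: "n = Suc m"
    using assms(2) by (cases n) auto
  have "Mersenne lam (n + 1) / real (n + 1) = (\<Sum>j=0..n. w j * (\<Sum>k=0..j. T j k))"
    using deg_Bernoulli_Bell_convolution[OF assms(1), of n x]
    by (simp add: w_def T_def b_def)
  \<comment> \<open>Only \<open>j = 0\<close> has a nonzero \<open>k = 0\<close> term; it yields the
    leading \<open>deg_ffact lam n (x + 1)\<close>.\<close>
  also have "\<dots> = w 0 * T 0 0 + (\<Sum>j=1..n. w j * (\<Sum>k=0..j. T j k))"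
    by (simp add: sum.atLeast_Suc_atMost[of 0])
  also have "(\<Sum>j=1..n. w j * (\<Sum>k=0..j. T j k)) = (\<Sum>j=1..n. w j * (\<Sum>k=1..j. T j k))"
    using T_drop_0 by (intro sum.cong) auto
  \<comment> \<open>The summand \<open>j = n\<close> has weight 1, and its \<open>k = 1\<close> term
    is the \<open>- b n\<close> to be solved for.\<close>
  also have "\<dots> = (\<Sum>j=1..n-1. w j * (\<Sum>k=1..j. T j k)) + w n * (\<Sum>k=1..n. T n k)"
    by (simp add: n)
  also have "(\<Sum>k=1..n. T n k) = T n 1 + (\<Sum>k=2..n. T n k)"
    using assms(2) by (simp add: sum.atLeast_Suc_atMost[of "Suc 0"] numeral_2_eq_2)
  also have "T n 1 = - b n"
    using assms(2) Bell_incomplete_1[of n b] by (simp add: T_def)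
  also have "w n = 1"
    by (simp add: w_def deg_ffact_def)
  also have "w 0 * T 0 0 = deg_ffact lam n (x + 1)"
    by (simp add: w_def T_def Bell_incomplete_0)
  finally show ?thesis
    by (simp add: w_def T_def b_def sum_distrib_left mult.assoc)
qed

end
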